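(* Let $N$ be a Nijenhuis operator on a $3$-Lie algebra $(\mathfrak g,[\cdot,\cdot,\cdot]_{\mathfrak g})$, and let $\mathfrak g_N=(\mathfrak g,[\cdot,\cdot,\cdot]_N)$ be the deformed $3$-Lie algebra. Define $\rho_N:\wedge^2\mathfrak g_N\to\mathfrak{gl}(\mathfrak g)$ by $$\rho_N(x,y)z=[Nx,Ny,z]_{\mathfrak g},\qquad x,y\in\mathfrak g_N,\ z\in\mathfrak g.$$ Then $(\mathfrak g;\rho_N)$ is a representation of the deformed $3$-Lie algebra $\mathfrak g_N$.
   Context: All vector spaces are over a fixed field. A 3-Lie algebra is a vector space $\mathfrak g$ with a skew-symmetric trilinear map $[\cdot,\cdot,\cdot]_{\mathfrak g}$ (i.e. a linear map $\wedge^3\mathfrak g\to\mathfrak g$) such that for all $x_1,\dots,x_5\in\mathfrak g$: $[x_1,x_2,[x_3,x_4,x_5]_{\mathfrak g}]_{\mathfrak g}=[[x_1,x_2,x_3]_{\mathfrak g},x_4,x_5]_{\mathfrak g}+[x_3,[x_1,x_2,x_4]_{\mathfrak g},x_5]_{\mathfrak g}+[x_3,x_4,[x_1,x_2,x_5]_{\mathfrak g}]_{\mathfrak g}$. A representation of a 3-Lie algebra $\mathfrak g$ is a pair $(V;\rho)$ with $V$ a vector space and $\rho:\wedge^2\mathfrak g\to\mathfrak{gl}(V)$ linear such that for all $x_1,\dots,x_4\in\mathfrak g$: (i) $[\rho(x_1,x_2),\rho(x_3,x_4)]=\rho([x_1,x_2,x_3]_{\mathfrak g},x_4)+\rho(x_3,[x_1,x_2,x_4]_{\mathfrak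 g})$ (commutator on the left); (ii) $\rho([x_1,x_2,x_3]_{\mathfrak g},x_4)=\rho(x_1,x_2)\rho(x_3,x_4)+\rho(x_2,x_3)\rho(x_1,x_4)+\rho(x_3,x_1)\rho(x_2,x_4)$. For a linear map $N:\mathfrak g\to\mathfrak g$ put $[x,y,z]_N=[Nx,Ny,z]_{\mathfrak g}+[x,Ny,Nz]_{\mathfrak g}+[Nx,y,Nz]_{\mathfrak g}-N[Nx,y,z]_{\mathfrak g}-N[x,Ny,z]_{\mathfrak g}-N[x,y,Nz]_{\mathfrak g}+N^2[x,y,z]_{\mathfrak g}$. $N$ is a Nijenhuis operator if $[Nx,Ny,Nz]_{\mathfrak g}=N([x,y,z]_N)$ for all $x,y,z\in\mathfrak g$. It is known that in this case $\mathfrak g_N:=(\mathfrak g,[\cdot,\cdot,\cdot]_N)$ is a 3-Lie algebra, called the deformed 3-Lie algebra. *)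

theory Defs
  imports Complex_Main
begin

text \<open>
  A linear map out of an exterior power is encoded as an alternating multilinear map:
  linear in each argument and zero whenever two arguments coincide.  Over a field of
  characteristic 2 this is stronger than changing sign under transpositions, which would
  not suffice for factoring through the exterior power.
\<close>

locale three_lie_algebra = vector_space scale
  for scale :: "'k::field \<Rightarrow> 'g::ab_group_add \<Rightarrow> 'g" +
  fixes bracket :: "'g \<Rightarrow> 'g \<Rightarrow> 'g \<Rightarrow> 'g"
  assumes bracket_linear1: "Vector_Spaces.linear scale scale (\<lambda>x. bracket x y z)"
    and bracket_linear2: "Vector_Spaces.linear scale scale (\<lambda>y. bracket x y z)"
    and bracket_linear3: "Vector_Spaces.linear scale scale (\<lambda>z. bracket x y z)"
    and bracket_alternating12: "bracket x x z = 0"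
    and bracket_alternating23: "bracket x y y = 0"
    and bracket_alternating13: "bracket x y x = 0"
    and fundamental_identity:
      "bracket x1 x2 (bracket x3 x4 x5) =
         bracket (bracket x1 x2 x3) x4 x5 + bracket x3 (bracket x1 x2 x4) x5
         + bracket x3 x4 (bracket x1 x2 x5)"

text \<open>
  Here \<open>\<rho> x y :: 'v \<Rightarrow> 'v\<close> is required to be linear, that is, an element of gl(V).
  Since the operations of gl(V) are pointwise, linearity of \<open>\<rho>\<close> as a map into gl(V) and
  the identities between elements of gl(V) are stated at an arbitrary vector \<open>v\<close>.
\<close>

locale three_lie_representation =
  three_lie_algebra scale bracket + V: vector_space scaleV
  for scale :: "'k::field \<Rightarrow> 'g::ab_group_add \<Rightarrow> 'g"
    and bracket :: "'g \<Rightarrow> 'g \<Rightarrow> 'g \<Rightarrow> 'g"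
    and scaleV :: "'k \<Rightarrow> 'v::ab_group_add \<Rightarrow> 'v" +
  fixes \<rho> :: "'g \<Rightarrow> 'g \<Rightarrow> 'v \<Rightarrow> 'v"
  assumes rho_endomorphism: "Vector_Spaces.linear scaleV scaleV (\<rho> x y)"
    and rho_linear1: "Vector_Spaces.linear scale scaleV (\<lambda>x. \<rho> x y v)"
    and rho_linear2: "Vector_Spaces.linear scale scaleV (\<lambda>y. \<rho> x y v)"
    and rho_alternating: "\<rho> x x v = 0"
    and rho_commutator:
      "\<rho> x1 x2 (\<rho> x3 x4 v) - \<rho> x3 x4 (\<rho> x1 x2 v) =
         \<rho> (bracket x1 x2 x3) x4 v + \<rho> x3 (bracket x1 x2 x4) v"
    and rho_bracket:
      "\<rho> (bracket x1 x2 x3) x4 v =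
         \<rho> x1 x2 (\<rho> x3 x4 v) + \<rho> x2 x3 (\<rho> x1 x4 v) + \<rho> x3 x1 (\<rho> x2 x4 v)"

definition deformed_bracket ::
    "('g::ab_group_add \<Rightarrow> 'g \<Rightarrow> 'g \<Rightarrow> 'g) \<Rightarrow> ('g \<Rightarrow> 'g) \<Rightarrow> 'g \<Rightarrow> 'g \<Rightarrow> 'g \<Rightarrow> 'g" where
  "deformed_bracket bracket N x y z =
     bracket (N x) (N y) z + bracket x (N y) (N z) + bracket (N x) y (N z)
     - N (bracket (N x) y z) - N (bracket x (N y) z) - N (bracket x y (N z))
     + N (N (bracket x y z))"

locale nijenhuis_operator = three_lie_algebra scale bracket
  for scale :: "'k::field \<Rightarrow> 'g::ab_group_add \<Rightarrow> 'g"
    and bracket :: "'g \<Rightarrow> 'g \<Rightarrow> 'g \<Rightarrow> 'g" +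
  fixes N :: "'g \<Rightarrow> 'g"
  assumes N_linear: "Vector_Spaces.linear scale scale N"
    and nijenhuis: "bracket (N x) (N y) (N z) = N (deformed_bracket bracket N x y z)"

definition nijenhuis_rho ::
    "('g \<Rightarrow> 'g \<Rightarrow> 'g \<Rightarrow> 'g) \<Rightarrow> ('g \<Rightarrow> 'g) \<Rightarrow> 'g \<Rightarrow> 'g \<Rightarrow> 'g \<Rightarrow> 'g" where
  "nijenhuis_rho bracket N x y z = bracket (N x) (N y) z"

end

theory Submission imports Defs begin

text \<open>
  The operators \<open>\<omega>\<^sub>0, \<omega>\<^sub>1, \<omega>\<^sub>2\<close>, with \<open>\<omega>\<^sub>0\<close> the bracket and \<open>\<omega>\<^sub>2\<close> the deformed bracket, are the
  coefficients of the unique \<open>\<omega>\<^sub>t\<close> with \<open>(1 + t N) (\<omega>\<^sub>t x y z) = [(1 + t N) x, (1 + t N) y, (1 + t N) z]\<close>;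
  the Nijenhuis condition says that \<open>\<omega>\<^sub>t\<close> has degree 2 in \<open>t\<close>.  As \<open>1 + t N\<close> is formally invertible,
  \<open>\<omega>\<^sub>t\<close> inherits the fundamental identity, and the coefficient of \<open>t^4\<close> is the fundamental identity of
  the deformed bracket.  Writing \<open>J\<^sub>k\<close> for the coefficient of \<open>t^k\<close> in the defect of the identity,
  the inversion of \<open>1 + t N\<close> becomes the recursion \<open>J\<^sub>k + N J\<^sub>k\<^sub>-\<^sub>1 = 0\<close>.

  Both representation axioms are the fundamental identity at elements in the image of \<open>N\<close>, because
  the Nijenhuis condition reads \<open>N [x, y, z]\<^sub>N = [N x, N y, N z]\<close>.
\<close>

context three_lie_algebra
begin

lemma linear_endoI:
  assumes "\<And>x y. f (x + y) = f x + f y" "\<And>c x. f (scale c x) = scale c (f x)"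
  shows "Vector_Spaces.linear scale scale f"
  unfolding Vector_Spaces.linear_iff using assms vector_space_axioms by blast

lemma linear_endoD:
  assumes "Vector_Spaces.linear scale scale f"
  shows "f (x + y) = f x + f y" "f (scale c x) = scale c (f x)"
    "f (x - y) = f x - f y" "f (- x) = - f x" "f 0 = 0"
proof -
  interpret f: Vector_Spaces.linear scale scale f by fact
  show "f (x + y) = f x + f y" "f (scale c x) = scale c (f x)"
    "f (x - y) = f x - f y" "f (- x) = - f x" "f 0 = 0"
    by (simp_all add: f.add f.scale f.diff f.neg f.zero)
qed

lemmas bracket_simps =
  linear_endoD[OF bracket_linear1] linear_endoD[OF bracket_linear2] linear_endoD[OF bracket_linear3]

lemma bracket_swap12: "bracket y x z = - bracket x y z"
proof -
  have "bracket (x + y) (x + y) z = 0" by (rule bracket_alternating12)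
  then have "bracket y x z + bracket x y z = 0"
    unfolding bracket_simps by (simp add: bracket_alternating12 add.commute)
  then show ?thesis by (simp add: eq_neg_iff_add_eq_0)
qed

lemma bracket_swap23: "bracket x z y = - bracket x y z"
proof -
  have "bracket x (y + z) (y + z) = 0" by (rule bracket_alternating23)
  then have "bracket x z y + bracket x y z = 0"
    unfolding bracket_simps by (simp add: bracket_alternating23 add.commute)
  then show ?thesis by (simp add: eq_neg_iff_add_eq_0)
qed

lemma bracket_rotate: "bracket x y z = bracket y z x"
  by (metis bracket_swap12 bracket_swap23 minus_minus)

text \<open>Rotations of three arguments cost no sign, so every term takes the shape
  \<open>bracket a b (bracket c d e)\<close>, one five-argument expression at permuted
  arguments.\<close>

lemma fundamental_identity_cyclic:
  "bracket x1 x2 (bracket x3 x4 x5) =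
     bracket x4 x5 (bracket x1 x2 x3) + bracket x5 x3 (bracket x1 x2 x4)
     + bracket x3 x4 (bracket x1 x2 x5)"
  using fundamental_identity[of x1 x2 x3 x4 x5] by (metis bracket_rotate)

text \<open>The cyclic identity for the pair \<open>x4\<close>, \<open>v\<close> acting on
  \<open>bracket x1 x2 x3\<close>, rotated so that \<open>v\<close> is innermost, as the second
  representation axiom requires.\<close>

lemma bracket_bracket:
  "bracket (bracket x1 x2 x3) x4 v =
     bracket x1 x2 (bracket x3 x4 v) + bracket x2 x3 (bracket x1 x4 v)
     + bracket x3 x1 (bracket x2 x4 v)"
  using fundamental_identity_cyclic[of x4 v x1 x2 x3]
  by (metis bracket_rotate add.commute add.left_commute)

end

context nijenhuis_operator
begin

lemmas N_simps = linear_endoD[OF N_linear]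

text \<open>Measures the failure of \<open>N\<close> to be a derivation of the bracket.\<close>

definition omega1 :: "'g \<Rightarrow> 'g \<Rightarrow> 'g \<Rightarrow> 'g" where
  "omega1 x y z =
     bracket (N x) y z + bracket x (N y) z + bracket x y (N z) - N (bracket x y z)"

abbreviation omega2 :: "'g \<Rightarrow> 'g \<Rightarrow> 'g \<Rightarrow> 'g" where
  "omega2 \<equiv> deformed_bracket bracket N"

lemma omega1_add_N:
  "omega1 x y z + N (bracket x y z) = bracket (N x) y z + bracket x (N y) z + bracket x y (N z)"
  by (simp add: omega1_def)

lemma omega2_add_N:
  "omega2 x y z + N (omega1 x y z) =
     bracket (N x) (N y) z + bracket (N x) y (N z) + bracket x (N y) (N z)"
  by (simp add: omega1_def deformed_bracket_def N_simps)

lemma N_omega2: "N (omega2 x y z) = bracket (N x) (N y) (N z)"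
  by (simp add: nijenhuis)

lemma omega1_rotate: "omega1 x y z = omega1 y z x"
  unfolding omega1_def
  by (simp add: bracket_rotate[of x] bracket_rotate[of "N x"] add_ac)

lemma omega2_rotate: "omega2 x y z = omega2 y z x"
  unfolding deformed_bracket_def
  by (simp add: bracket_rotate[of x] bracket_rotate[of "N x"] algebra_simps)

text \<open>
  The next four lemmas give the coefficients of \<open>t, \<dots>, t^4\<close> of \<open>(1 + t N) (\<omega>\<^sub>t x y u\<^sub>t)\<close> for
  \<open>u\<^sub>t = u0 + t u1 + t^2 u2\<close>.
\<close>

lemma omega_coeff1:
  "bracket x y u1 + omega1 x y u0 + N (bracket x y u0) =
     bracket (N x) y u0 + bracket x (N y) u0 + bracket x y (u1 + N u0)"
  using omega1_add_N[of x y u0] by (simp add: bracket_simps algebra_simps)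

lemma omega_coeff2:
  "bracket x y u2 + omega1 x y u1 + omega2 x y u0 + N (bracket x y u1 + omega1 x y u0) =
     bracket (N x) (N y) u0 + bracket (N x) y (u1 + N u0) + bracket x (N y) (u1 + N u0)
     + bracket x y (u2 + N u1)"
proof -
  have "bracket x y u2 + omega1 x y u1 + omega2 x y u0 + N (bracket x y u1 + omega1 x y u0) =
    bracket x y u2 + (omega1 x y u1 + N (bracket x y u1)) + (omega2 x y u0 + N (omega1 x y u0))"
    by (simp add: N_simps)
  then show ?thesis
    unfolding omega1_add_N omega2_add_N by (simp add: bracket_simps)
qed

lemma omega_coeff3:
  "omega1 x y u2 + omega2 x y u1 + N (bracket x y u2 + omega1 x y u1 + omega2 x y u0) =
     bracket (N x) (N y) (u1 + N u0) + bracket (N x) y (u2 + N u1) + bracket x (N y) (u2 + N u1)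
     + bracket x y (N u2)"
proof -
  have "omega1 x y u2 + omega2 x y u1 + N (bracket x y u2 + omega1 x y u1 + omega2 x y u0) =
    (omega1 x y u2 + N (bracket x y u2)) + (omega2 x y u1 + N (omega1 x y u1)) + N (omega2 x y u0)"
    by (simp add: N_simps)
  then show ?thesis
    unfolding omega1_add_N omega2_add_N N_omega2 by (simp add: bracket_simps)
qed

lemma omega_coeff4:
  "omega2 x y u2 + N (omega1 x y u2 + omega2 x y u1) =
     bracket (N x) (N y) (u2 + N u1) + bracket (N x) y (N u2) + bracket x (N y) (N u2)"
proof -
  have "omega2 x y u2 + N (omega1 x y u2 + omega2 x y u1) =
    (omega2 x y u2 + N (omega1 x y u2)) + N (omega2 x y u1)"
    by (simp add: N_simps)
  then show ?thesis
    unfolding omega2_add_N N_omega2 by (simp add: bracket_simps)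
qed

text \<open>\<open>F\<close> stands for a whole nested operation, so that sums mixing two different
  operations are covered and the defect is additive in \<open>F\<close>.\<close>

definition fi_defect :: "('g \<Rightarrow> 'g \<Rightarrow> 'g \<Rightarrow> 'g \<Rightarrow> 'g \<Rightarrow> 'g) \<Rightarrow> 'g \<Rightarrow> 'g \<Rightarrow> 'g \<Rightarrow> 'g \<Rightarrow> 'g \<Rightarrow> 'g" where
  "fi_defect F x1 x2 x3 x4 x5 =
     F x1 x2 x3 x4 x5 - F x4 x5 x1 x2 x3 - F x5 x3 x1 x2 x4 - F x3 x4 x1 x2 x5"

lemma fi_defect_add_N:
  "fi_defect (\<lambda>a b c d e. F a b c d e + N (G a b c d e)) x1 x2 x3 x4 x5 =
     fi_defect F x1 x2 x3 x4 x5 + N (fi_defect G x1 x2 x3 x4 x5)"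
  by (simp add: fi_defect_def N_simps)

text \<open>One step of the recursion: \<open>F\<close> and \<open>G\<close> are the nested
  coefficients of orders k and k-1, and \<open>H\<close> is their combination rewritten by the
  coefficient formulas.\<close>

lemma fi_defect_step:
  assumes "\<And>a b c d e. F a b c d e + N (G a b c d e) = H a b c d e"
    and "fi_defect G x1 x2 x3 x4 x5 = 0" and "fi_defect H x1 x2 x3 x4 x5 = 0"
  shows "fi_defect F x1 x2 x3 x4 x5 = 0"
  using fi_defect_add_N[of F G x1 x2 x3 x4 x5] assms by (simp add: N_simps)

lemma fi_defect_bracket: "fi_defect (\<lambda>a b c d e. bracket a b (bracket c d e)) x1 x2 x3 x4 x5 = 0"
  using fundamental_identity_cyclic[of x1 x2 x3 x4 x5] by (simp add: fi_defect_def)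

lemma fi_defect1:
  "fi_defect (\<lambda>a b c d e. bracket a b (omega1 c d e) + omega1 a b (bracket c d e))
     x1 x2 x3 x4 x5 = 0"
  \<comment> \<open>What remains is a sum of nested original brackets with \<open>N\<close> put on
    one of the five arguments; the identity holds for each placement. At order k the placements are
    the k-element subsets of the arguments.\<close>
  apply (rule fi_defect_step[OF omega_coeff1 fi_defect_bracket])
  unfolding omega1_add_N fi_defect_def bracket_simps
    fundamental_identity_cyclic[of "N x1" x2 x3 x4 x5]
    fundamental_identity_cyclic[of x1 "N x2" x3 x4 x5]
    fundamental_identity_cyclic[of x1 x2 "N x3" x4 x5]
    fundamental_identity_cyclic[of x1 x2 x3 "N x4" x5]
    fundamental_identity_cyclic[of x1 x2 x3 x4 "N x5"]
  by (simp add: algebra_simps)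

lemma fi_defect2:
  "fi_defect (\<lambda>a b c d e. bracket a b (omega2 c d e) + omega1 a b (omega1 c d e) + omega2 a b (bracket c d e))
     x1 x2 x3 x4 x5 = 0"
  apply (rule fi_defect_step[OF omega_coeff2 fi_defect1])
  unfolding omega1_add_N omega2_add_N fi_defect_def bracket_simps
    fundamental_identity_cyclic[of "N x1" "N x2" x3 x4 x5]
    fundamental_identity_cyclic[of "N x1" x2 "N x3" x4 x5]
    fundamental_identity_cyclic[of "N x1" x2 x3 "N x4" x5]
    fundamental_identity_cyclic[of "N x1" x2 x3 x4 "N x5"]
    fundamental_identity_cyclic[of x1 "N x2" "N x3" x4 x5]
    fundamental_identity_cyclic[of x1 "N x2" x3 "N x4" x5]
    fundamental_identity_cyclic[of x1 "N x2" x3 x4 "N x5"]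
    fundamental_identity_cyclic[of x1 x2 "N x3" "N x4" x5]
    fundamental_identity_cyclic[of x1 x2 "N x3" x4 "N x5"]
    fundamental_identity_cyclic[of x1 x2 x3 "N x4" "N x5"]
  by (simp add: algebra_simps)

lemma fi_defect3:
  "fi_defect (\<lambda>a b c d e. omega1 a b (omega2 c d e) + omega2 a b (omega1 c d e))
     x1 x2 x3 x4 x5 = 0"
  apply (rule fi_defect_step[OF omega_coeff3 fi_defect2])
  unfolding omega1_add_N omega2_add_N N_omega2 fi_defect_def bracket_simps
    fundamental_identity_cyclic[of "N x1" "N x2" "N x3" x4 x5]
    fundamental_identity_cyclic[of "N x1" "N x2" x3 "N x4" x5]
    fundamental_identity_cyclic[of "N x1" "N x2" x3 x4 "N x5"]
    fundamental_identity_cyclic[of "N x1" x2 "N x3" "N x4" x5]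
    fundamental_identity_cyclic[of "N x1" x2 "N x3" x4 "N x5"]
    fundamental_identity_cyclic[of "N x1" x2 x3 "N x4" "N x5"]
    fundamental_identity_cyclic[of x1 "N x2" "N x3" "N x4" x5]
    fundamental_identity_cyclic[of x1 "N x2" "N x3" x4 "N x5"]
    fundamental_identity_cyclic[of x1 "N x2" x3 "N x4" "N x5"]
    fundamental_identity_cyclic[of x1 x2 "N x3" "N x4" "N x5"]
  by (simp add: algebra_simps)

lemma fi_defect4:
  "fi_defect (\<lambda>a b c d e. omega2 a b (omega2 c d e))
     x1 x2 x3 x4 x5 = 0"
  apply (rule fi_defect_step[OF omega_coeff4 fi_defect3])
  unfolding omega2_add_N N_omega2 fi_defect_def bracket_simps
    fundamental_identity_cyclic[of "N x1" "N x2" "N x3" "N x4" x5]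
    fundamental_identity_cyclic[of "N x1" "N x2" "N x3" x4 "N x5"]
    fundamental_identity_cyclic[of "N x1" "N x2" x3 "N x4" "N x5"]
    fundamental_identity_cyclic[of "N x1" x2 "N x3" "N x4" "N x5"]
    fundamental_identity_cyclic[of x1 "N x2" "N x3" "N x4" "N x5"]
  by (simp add: algebra_simps)

lemma omega2_fundamental_identity:
  "omega2 x1 x2 (omega2 x3 x4 x5) =
     omega2 (omega2 x1 x2 x3) x4 x5 + omega2 x3 (omega2 x1 x2 x4) x5
     + omega2 x3 x4 (omega2 x1 x2 x5)"
  using fi_defect4[of x1 x2 x3 x4 x5]
    omega2_rotate[of "omega2 x1 x2 x3" x4 x5] omega2_rotate[of x5 x3 "omega2 x1 x2 x4"]
  by (simp add: fi_defect_def algebra_simps)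

lemma omega2_alternating:
  "omega2 x x z = 0" "omega2 x y y = 0" "omega2 x y x = 0"
proof -
  show *: "omega2 x x z = 0" for x z
    \<comment> \<open>The terms with \<open>N\<close> on exactly one of the two equal arguments
      cancel in pairs; the others vanish because \<open>bracket\<close> is alternating.\<close>
    using bracket_swap12[of "N x" x]
    by (simp add: deformed_bracket_def bracket_alternating12 N_simps)
  show "omega2 x y y = 0" "omega2 x y x = 0"
    using * omega2_rotate by metis+
qed

text \<open>A representation presupposes a 3-Lie algebra, so this precedes the axioms for
  \<open>nijenhuis_rho\<close>.\<close>

sublocale deformed: three_lie_algebra scale omega2
proof (intro three_lie_algebra.intro three_lie_algebra_axioms.intro vector_space_axioms)
  show "Vector_Spaces.linear scale scale (\<lambda>x. omega2 x y z)"
    and "Vector_Spaces.linear scale scale (\<lambda>y. omega2 x y z)"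
    and "Vector_Spaces.linear scale scale (\<lambda>z. omega2 x y z)" for x y z
    by (rule linear_endoI;
        simp add: deformed_bracket_def bracket_simps N_simps scale_right_distrib
          scale_right_diff_distrib)+
qed (fact omega2_alternating omega2_fundamental_identity)+

lemma three_lie_representation_deformed:
  "three_lie_representation scale omega2 scale (nijenhuis_rho bracket N)"
proof (intro three_lie_representation.intro three_lie_representation_axioms.intro
    deformed.three_lie_algebra_axioms vector_space_axioms)
  show "Vector_Spaces.linear scale scale (nijenhuis_rho bracket N x y)"
    and "Vector_Spaces.linear scale scale (\<lambda>x. nijenhuis_rho bracket N x y v)"
    and "Vector_Spaces.linear scale scale (\<lambda>y. nijenhuis_rho bracket N x y v)" for x y v
    by (rule linear_endoI; simp add: nijenhuis_rho_def bracket_simps N_simps)+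
  show "nijenhuis_rho bracket N x x v = 0" for x v
    by (simp add: nijenhuis_rho_def bracket_alternating12)
  show "nijenhuis_rho bracket N x1 x2 (nijenhuis_rho bracket N x3 x4 v)
      - nijenhuis_rho bracket N x3 x4 (nijenhuis_rho bracket N x1 x2 v) =
    nijenhuis_rho bracket N (omega2 x1 x2 x3) x4 v + nijenhuis_rho bracket N x3 (omega2 x1 x2 x4) v"
    for x1 x2 x3 x4 v
    using fundamental_identity[of "N x1" "N x2" "N x3" "N x4" v]
    by (simp add: nijenhuis_rho_def N_omega2)
  show "nijenhuis_rho bracket N (omega2 x1 x2 x3) x4 v =
    nijenhuis_rho bracket N x1 x2 (nijenhuis_rho bracket N x3 x4 v)
      + nijenhuis_rho bracket N x2 x3 (nijenhuis_rho bracket N x1 x4 v)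
      + nijenhuis_rho bracket N x3 x1 (nijenhuis_rho bracket N x2 x4 v)"
    for x1 x2 x3 x4 v
    using bracket_bracket[of "N x1" "N x2" "N x3" "N x4" v]
    by (simp add: nijenhuis_rho_def N_omega2)
qed

end

theorem lemma4p1:
  fixes scale :: "'k::field \<Rightarrow> 'g::ab_group_add \<Rightarrow> 'g"
    and bracket :: "'g \<Rightarrow> 'g \<Rightarrow> 'g \<Rightarrow> 'g"
    and N :: "'g \<Rightarrow> 'g"
  assumes "nijenhuis_operator scale bracket N"
  shows "three_lie_representation scale (deformed_bracket bracket N) scale (nijenhuis_rho bracket N)"
  using assms by (rule nijenhuis_operator.three_lie_representation_deformed)

end
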